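(* Let $(L,\leq,0,1)$ be a bounded lattice, $e\in L\setminus\{0,1\}$, and let $T_e$ be a $t$-norm on $[0,e]$. Let $U_{T_e}: L^2\to L$ be defined by $$ U_{T_e}(x,y)=\begin{cases} T_e(x,y), & (x,y)\in [0,e]^2,\\ y, & (x,y)\in [e,1]\times I_e,\\ x, & (x,y)\in I_e\times [e,1],\\ 0, & (x,y)\in ([0,e)\times I_e)\cup(I_e\times[0,e)),\\ x\wedge y, & (x,y)\in ([0,e)\times [e,1])\cup([e,1]\times[0,e))\cup(I_e\times I_e),\\ x\vee y, & \text{otherwise.} \end{cases} $$ Let $\mathscr{P}=\{x\in(0,e): \exists\, y\in I_e,\ x\leq y\}$. Then the following statements are equivalent: (i) $U_{T_e}$ is a uninorm on $L$ with the neutral element $e$; (ii) both of the following hold: (ii-1) $\mathscr{P}=\emptyset$, or $T_e(x,y)=0$ for all $(x,y)\in(\mathscr{P}\times[0,e))\cup([0,e)\times\mathscr{P})$; (ii-2) $I_e\wedge I_e\subset I_e\cup\{0\}$.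
   Context: $(L,\leq,0,1)$ is a lattice with bottom element $0$ and top element $1$; $\wedge,\vee$ are infimum and supremum; $x<y$ means $x\leq y$ and $x\neq y$. For $a\leq b$, $[a,b]=\{x\in L: a\leq x\leq b\}$, and $[a,b)$, $(a,b]$, $(a,b)$ are defined similarly (with strict inequality $<$ at the open end). Elements $x,y$ are incomparable, written $x\| y$, if $x\nleq y$ and $y\nleq x$; $I_e=\{x\in L: x\| e\}$. $I_e\wedge I_e=\{y\wedge z: y,z\in I_e\}$. The symbol $\subset$ allows equality. A uninorm on $L$ is a binary operation $U:L^2\to L$ that is commutative, associative, increasing (i.e. order-preserving) in each variable, and has a neutral element $e\in L$, i.e. $U(e,x)=x$ for all $x\in L$. A $t$-norm on $[0,e]$ is a commutative, associative operation $[0,e]^2\to[0,e]$, increasing in each variable, with neutral element $e$. (The first and fifth cases in the definition of $U_{T_e}$ overlap at pairs $(x,e)$, $(e,x)$ with $x\in[0,e)$, where they agree, since $T_e(x,e)=x=x\wedge e$.) *)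

theory Defs
  imports Main
begin

definition incomparables :: "'a::order \<Rightarrow> 'a set" where
  "incomparables e = {x. \<not> x \<le> e \<and> \<not> e \<le> x}"

definition inf_set :: "'a::lattice set \<Rightarrow> 'a set \<Rightarrow> 'a set" where
  "inf_set A B = {inf y z | y z. y \<in> A \<and> z \<in> B}"

definition uninorm :: "('a::order \<Rightarrow> 'a \<Rightarrow> 'a) \<Rightarrow> 'a \<Rightarrow> bool" where
  "uninorm U e \<longleftrightarrow>
     (\<forall>x y. U x y = U y x) \<and>
     (\<forall>x y z. U (U x y) z = U x (U y z)) \<and>
     (\<forall>y. mono (\<lambda>x. U x y)) \<and> (\<forall>x. mono (\<lambda>y. U x y)) \<and>
     (\<forall>x. U e x = x)"

(* The operation is a total function on the whole type; only its values on
   {bot..e} are constrained, and {bot..e} must be closed under it. *)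
definition tnorm_below :: "'a::order_bot \<Rightarrow> ('a \<Rightarrow> 'a \<Rightarrow> 'a) \<Rightarrow> bool" where
  "tnorm_below e T \<longleftrightarrow>
     (\<forall>x\<in>{bot..e}. \<forall>y\<in>{bot..e}. T x y \<in> {bot..e}) \<and>
     (\<forall>x\<in>{bot..e}. \<forall>y\<in>{bot..e}. T x y = T y x) \<and>
     (\<forall>x\<in>{bot..e}. \<forall>y\<in>{bot..e}. \<forall>z\<in>{bot..e}. T (T x y) z = T x (T y z)) \<and>
     (\<forall>y\<in>{bot..e}. mono_on {bot..e} (\<lambda>x. T x y)) \<and>
     (\<forall>x\<in>{bot..e}. mono_on {bot..e} (\<lambda>y. T x y)) \<and>
     (\<forall>x\<in>{bot..e}. T e x = x)"

(* The first and fifth cases overlap at pairs (x, e) and (e, x) with x < e; for a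
   t-norm T they agree there, so the order of the tests is immaterial. *)
definition U_of_tnorm ::
    "('a::bounded_lattice \<Rightarrow> 'a \<Rightarrow> 'a) \<Rightarrow> 'a \<Rightarrow> 'a \<Rightarrow> 'a \<Rightarrow> 'a" where
  "U_of_tnorm T e x y =
    (if (x, y) \<in> {bot..e} \<times> {bot..e} then T x y
     else if (x, y) \<in> {e..top} \<times> incomparables e then y
     else if (x, y) \<in> incomparables e \<times> {e..top} then x
     else if (x, y) \<in> ({bot..<e} \<times> incomparables e) \<union> (incomparables e \<times> {bot..<e}) then bot
     else if (x, y) \<in> ({bot..<e} \<times> {e..top}) \<union> ({e..top} \<times> {bot..<e})
                      \<union> (incomparables e \<times> incomparables e) then inf x y
     else sup x y)"

definition P_set :: "'a::bounded_lattice \<Rightarrow> 'a set" where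
  "P_set e = {x \<in> {bot<..<e}. \<exists>y\<in>incomparables e. x \<le> y}"

end

theory Submission
  imports Defs
begin

text \<open>The lattice splits into \<open>[bot, e)\<close>, \<open>[e, top]\<close> and the
  elements incomparable to \<open>e\<close>, and on each pair of blocks the operation is one simple
  formula; commutativity and neutrality of \<open>e\<close> can be read off this table. Monotonicity
  is at risk only when an argument moves from \<open>[bot, e)\<close> up to an incomparable element
  while the other stays below \<open>e\<close>: the value passes from \<open>T x y\<close> to
  \<open>bot\<close>, so \<open>T\<close> must vanish on \<open>P_set e\<close>
  (\<open>U_mono\<close>, \<open>T_P_set_eq_bot\<close>). Associativity is at risk only when an
  infimum of incomparable elements lands in \<open>(bot, e)\<close>, where the next product with an
  incomparable element becomes \<open>bot\<close> (\<open>U_assoc\<close>,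
  \<open>inf_incomparables\<close>).\<close>

lemma trichotomy_incomparables:
  fixes e :: "'a::order"
  obtains "x < e" | "e \<le> x" | "x \<in> incomparables e"
  unfolding incomparables_def by (auto simp: less_le)

context
  fixes e :: "'a::bounded_lattice" and T :: "'a \<Rightarrow> 'a \<Rightarrow> 'a"
  assumes tnorm: "tnorm_below e T"
begin

lemma T_commute: "x \<le> e \<Longrightarrow> y \<le> e \<Longrightarrow> T x y = T y x"
  using tnorm unfolding tnorm_below_def by simp

lemma T_neutral:
  assumes "x \<le> e"
  shows "T e x = x" "T x e = x"
proof -
  show "T e x = x"
    using tnorm assms by (simp add: tnorm_below_def)
  then show "T x e = x"
    using T_commute[of x e] assms by simp
qed

lemma T_assoc:
  assumes "x \<le> e" "y \<le> e" "z \<le> e"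
  shows "T (T x y) z = T x (T y z)"
proof -
  have "\<forall>x\<in>{bot..e}. \<forall>y\<in>{bot..e}. \<forall>z\<in>{bot..e}. T (T x y) z = T x (T y z)"
    using tnorm unfolding tnorm_below_def by (elim conjE)
  with assms show ?thesis by simp
qed

lemma T_mono:
  assumes "x \<le> x'" "x' \<le> e" "y \<le> e"
  shows "T x y \<le> T x' y"
proof -
  have "mono_on {bot..e} (\<lambda>x. T x y)"
    using tnorm assms(3) by (simp add: tnorm_below_def)
  then show ?thesis
    by (rule mono_onD) (use assms in \<open>auto intro: order_trans\<close>)
qed

lemma T_le:
  assumes "x \<le> e" "y \<le> e"
  shows "T x y \<le> x" "T x y \<le> y"
  using T_mono[of x e y] T_mono[of y e x] T_neutral T_commute assms by auto

text \<open>Keeps an inner product in the block \<open>[bot, e)\<close>, so that the outer product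
  in associativity can be evaluated again.\<close>

lemma T_less:
  assumes "x < e" "y < e"
  shows "T x y < e"
  using T_le(1)[of x y] assms by (meson le_less_trans less_imp_le)

lemma T_bot:
  assumes "x \<le> e"
  shows "T bot x = bot" "T x bot = bot"
  using T_le[of bot x] T_le[of x bot] assms by (auto simp: bot_unique)

text \<open>Start of the block table that replaces the nested conditionals. The point
  \<open>e\<close> is counted in the upper block, which makes the three blocks disjoint.\<close>

lemma U_lower: "x < e \<Longrightarrow> y < e \<Longrightarrow> U_of_tnorm T e x y = T x y"
  by (simp add: U_of_tnorm_def less_imp_le)

lemma U_lower_upper:
  assumes "x < e" "e \<le> y"
  shows "U_of_tnorm T e x y = x" "U_of_tnorm T e y x = x"
proof -
  \<comment> \<open>The \<open>T\<close> branch applies only at \<open>y = e\<close>, where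
    neutrality gives the same value \<open>x\<close> as the infimum.\<close>
  have "x \<le> y" "\<not> e \<le> x" "x \<le> e" "y \<le> e \<longleftrightarrow> y = e"
    using assms by auto
  with assms show "U_of_tnorm T e x y = x" "U_of_tnorm T e y x = x"
    by (auto simp: U_of_tnorm_def incomparables_def inf_absorb1 inf_absorb2 T_neutral)
qed

lemma U_lower_incomparable:
  assumes "x < e" "y \<in> incomparables e"
  shows "U_of_tnorm T e x y = bot" "U_of_tnorm T e y x = bot"
  using assms by (auto simp: U_of_tnorm_def incomparables_def)

lemma U_upper:
  assumes "e \<le> x" "e \<le> y"
  shows "U_of_tnorm T e x y = sup x y"
proof (cases "x = e \<and> y = e")
  case True
  then show ?thesis by (simp add: U_of_tnorm_def T_neutral)
next
  case False
  with assms show ?thesis by (auto simp: U_of_tnorm_def incomparables_def)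
qed

lemma U_upper_incomparable:
  assumes "e \<le> x" "y \<in> incomparables e"
  shows "U_of_tnorm T e x y = y" "U_of_tnorm T e y x = y"
  using assms by (auto simp: U_of_tnorm_def incomparables_def)

lemma U_incomparable:
  "x \<in> incomparables e \<Longrightarrow> y \<in> incomparables e \<Longrightarrow> U_of_tnorm T e x y = inf x y"
  by (auto simp: U_of_tnorm_def incomparables_def)

lemmas U_simps = U_lower U_lower_upper U_lower_incomparable U_upper
  U_upper_incomparable U_incomparable

lemma U_commute: "U_of_tnorm T e x y = U_of_tnorm T e y x"
  by (cases x rule: trichotomy_incomparables[of _ e];
      cases y rule: trichotomy_incomparables[of _ e])
    (simp_all add: U_simps less_imp_le T_commute inf_commute sup_commute)

lemma U_neutral: "U_of_tnorm T e e x = x"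
  by (cases x rule: trichotomy_incomparables[of _ e])
    (simp_all add: U_simps sup_absorb2)

lemma U_bot:
  assumes "bot < e"
  shows "U_of_tnorm T e bot x = bot" "U_of_tnorm T e x bot = bot"
  by (cases x rule: trichotomy_incomparables[of _ e];
      simp add: U_simps less_imp_le T_bot assms)+

text \<open>If both points lie in one block, the block formula is monotone. Moves into the upper
  block only increase the value, since \<open>T\<close> and \<open>inf\<close> lie below their
  arguments; a move from below \<open>e\<close> to an incomparable point uses the hypothesis on
  \<open>T\<close>.\<close>

lemma U_mono:
  assumes P: "\<And>x y. x \<in> P_set e \<Longrightarrow> y < e \<Longrightarrow> T x y = bot"
    and le: "x \<le> x'"
  shows "U_of_tnorm T e x y \<le> U_of_tnorm T e x' y"
proof -
  \<comment> \<open>Here \<open>x'\<close> witnesses \<open>x \<in> P_set e\<close> unless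
    \<open>x = bot\<close>, which \<open>P_set\<close> excludes and \<open>T_bot\<close>
    covers.\<close>
  have T_zero: "T x y = bot" if "x < e" "x' \<in> incomparables e" "y < e"
    using that P le T_bot(1)[of y] by (cases "x = bot") (auto simp: P_set_def bot.not_eq_extremum)
  have no: "x' < e \<Longrightarrow> e \<le> x \<Longrightarrow> False" "x' < e \<Longrightarrow> x \<in> incomparables e \<Longrightarrow> False"
    "e \<le> x \<Longrightarrow> x' \<in> incomparables e \<Longrightarrow> False"
    using le by (auto simp: incomparables_def)
  show ?thesis
    using le no
    by (cases x rule: trichotomy_incomparables[of _ e];
        cases x' rule: trichotomy_incomparables[of _ e];
        cases y rule: trichotomy_incomparables[of _ e])
      (auto simp: U_simps less_imp_le T_mono T_zero T_le le_supI1 le_infI1)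
qed

text \<open>In each of the 27 block combinations both sides reduce to the same expression, once the
  block of every inner value is known. This is automatic except for infima of incomparable elements,
  which \<open>inf\<close> places among the incomparable elements or at the annihilator
  \<open>bot\<close>.\<close>

lemma U_assoc:
  assumes bot: "bot < e"
    and inf: "\<And>x y. x \<in> incomparables e \<Longrightarrow> y \<in> incomparables e \<Longrightarrow>
      inf x y \<in> incomparables e \<or> inf x y = bot"
  shows "U_of_tnorm T e (U_of_tnorm T e x y) z = U_of_tnorm T e x (U_of_tnorm T e y z)"
proof -
  \<comment> \<open>These three facts evaluate products with \<open>inf a b\<close> uniformly in
    both alternatives, so the main case split need not branch on them.\<close>
  have inf_upper: "U_of_tnorm T e (inf a b) c = inf a b" "U_of_tnorm T e c (inf a b) = inf a b"
    if "a \<in> incomparables e" "b \<in> incomparables e" "e \<le> c" for a b c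
    using inf[OF that(1,2)] that(3) by (auto simp: U_simps U_bot bot)
  have inf_lower: "U_of_tnorm T e (inf a b) c = bot" "U_of_tnorm T e c (inf a b) = bot"
    if "a \<in> incomparables e" "b \<in> incomparables e" "c < e" for a b c
    using inf[OF that(1,2)] that(3) by (auto simp: U_simps U_bot T_bot less_imp_le bot)
  have inf_inf: "U_of_tnorm T e (inf a b) c = inf (inf a b) c"
    "U_of_tnorm T e c (inf a b) = inf c (inf a b)"
    if "a \<in> incomparables e" "b \<in> incomparables e" "c \<in> incomparables e" for a b c
    using inf[OF that(1,2)] that(3) by (auto simp: U_simps U_bot bot)
  show ?thesis
    by (cases x rule: trichotomy_incomparables[of _ e];
        cases y rule: trichotomy_incomparables[of _ e];
        cases z rule: trichotomy_incomparables[of _ e])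
      (simp_all add: U_simps U_bot bot less_imp_le T_less T_assoc T_bot inf_upper inf_lower inf_inf
        le_supI1 inf_assoc sup_assoc)
qed

lemma uninorm_U:
  assumes bot: "bot < e"
    and P: "\<And>x y. x \<in> P_set e \<Longrightarrow> y < e \<Longrightarrow> T x y = bot"
    and inf: "\<And>x y. x \<in> incomparables e \<Longrightarrow> y \<in> incomparables e \<Longrightarrow>
      inf x y \<in> incomparables e \<or> inf x y = bot"
  shows "uninorm (U_of_tnorm T e) e"
  unfolding uninorm_def
proof (intro conjI allI)
  show "mono (\<lambda>x. U_of_tnorm T e x y)" for y
    using U_mono[OF P] by (intro monoI)
  then show "mono (\<lambda>y. U_of_tnorm T e x y)" for x
    by (subst U_commute)
qed (rule U_commute U_assoc[OF bot inf] U_neutral | assumption)+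

text \<open>Replacing \<open>x\<close> by an incomparable \<open>w\<close> above it cannot decrease
  the product with \<open>y\<close>, yet \<open>U w y\<close> is already \<open>bot\<close>.\<close>

lemma T_P_set_eq_bot:
  assumes U: "uninorm (U_of_tnorm T e) e" and x: "x \<in> P_set e" and y: "y < e"
  shows "T x y = bot"
proof -
  obtain w where w: "w \<in> incomparables e" "x \<le> w" and "x < e"
    using x by (auto simp: P_set_def)
  have "U_of_tnorm T e x y \<le> U_of_tnorm T e w y"
    using U w(2) unfolding uninorm_def by (blast dest: monoD)
  then show ?thesis
    using \<open>x < e\<close> y w(1) by (simp add: U_simps bot_unique)
qed

text \<open>If \<open>w = inf y z\<close> lies below \<open>e\<close>, then \<open>U w y = bot\<close>, whereas associativity and
  idempotency of \<open>inf\<close> on the incomparable elements give \<open>U w y = w\<close>.\<close>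

lemma inf_incomparables:
  assumes U: "uninorm (U_of_tnorm T e) e"
    and y: "y \<in> incomparables e" and z: "z \<in> incomparables e"
  shows "inf y z \<in> incomparables e \<or> inf y z = bot"
proof (cases "inf y z" rule: trichotomy_incomparables[of _ e])
  case 1
  have "bot = U_of_tnorm T e (inf y z) y"
    using 1 y by (simp add: U_simps)
  also have "\<dots> = U_of_tnorm T e (U_of_tnorm T e z y) y"
    using y z by (simp add: U_simps inf_commute)
  also have "\<dots> = U_of_tnorm T e z (U_of_tnorm T e y y)"
    using U unfolding uninorm_def by blast
  also have "\<dots> = inf y z"
    using y z by (simp add: U_simps inf_commute)
  finally show ?thesis by simp
next
  case 2
  with y show ?thesis by (simp add: incomparables_def)
qed simp

end

theorem theorem11:
  fixes e :: "'a::bounded_lattice" and T :: "'a \<Rightarrow> 'a \<Rightarrow> 'a"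
  assumes "e \<notin> {bot, top}"
    and "tnorm_below e T"
  shows "uninorm (U_of_tnorm T e) e \<longleftrightarrow>
    (P_set e = {} \<or>
       (\<forall>(x, y) \<in> (P_set e \<times> {bot..<e}) \<union> ({bot..<e} \<times> P_set e). T x y = bot)) \<and>
    inf_set (incomparables e) (incomparables e) \<subseteq> incomparables e \<union> {bot}"
    (is "?U \<longleftrightarrow> ?P \<and> ?I")
proof
  assume U: ?U
  have "T x y = bot" "T y x = bot" if "x \<in> P_set e" "y < e" for x y
    using T_P_set_eq_bot[OF assms(2) U that] T_commute[OF assms(2), of x y] that
    by (auto simp: P_set_def)
  moreover have ?I
    using inf_incomparables[OF assms(2) U] by (auto simp: inf_set_def)
  ultimately show "?P \<and> ?I" by auto
next
  assume "?P \<and> ?I"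
  \<comment> \<open>Vacuous if \<open>P_set e\<close> is empty, so both disjuncts give this
    form.\<close>
  then have "T x y = bot" if "x \<in> P_set e" "y < e" for x y
    using that by auto
  moreover have "inf x y \<in> incomparables e \<or> inf x y = bot"
    if "x \<in> incomparables e" "y \<in> incomparables e" for x y
    using \<open>?P \<and> ?I\<close> that by (auto simp: inf_set_def)
  moreover have "bot < e"
    using assms(1) by (simp add: bot.not_eq_extremum)
  ultimately show ?U
    using uninorm_U[OF assms(2)] by blast
qed

end
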